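(* Let $z\in\overline{\Lambda}^{(1)}$. Then $z$ is invertible in $\overline{\Lambda}^{(1)}$ if and only if its body satisfies $z_B\neq 0$.
   Context: $\Lambda$ is the unital complex algebra generated by $1$ and countably many elements $i_1,i_2,\ldots$, linearly independent over $\mathbb{C}$, with $i_ni_m+i_mi_n=0$ for all $n,m$ (so $i_n^2=0$). Let $\mathfrak{I}$ be the set of finite strictly increasing nonempty tuples $\alpha=(a_1<\cdots<a_t)$ of positive integers, $i_\alpha=i_{a_1}\cdots i_{a_t}$, $\mathfrak{I}_0=\mathfrak{I}\cup\{0\}$ and $i_0=1$; the $i_\alpha$, $\alpha\in\mathfrak I_0$, form a basis of $\Lambda$. For $z=\sum_{\alpha\in\mathfrak{I}_0}z_\alpha i_\alpha$ with $z_\alpha\in\mathbb{C}$, put $\|z\|_1=\sum_{\alpha}|z_\alpha|$. $\overline{\Lambda}^{(1)}$ is the completion of $\Lambda$ for $\|\cdot\|_1$, i.e. the Banach algebra of all sums $\sum_{\alpha\in\mathfrak{I}_0} z_\alpha i_\alpha$ with $\sum|z_\alpha|<\infty$. The body of $z$ is $z_B=z_0\in\mathbb{C}$. *)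

theory Defs
  imports "HOL-Analysis.Analysis"
begin

text \<open>
  A strictly increasing tuple of positive integers is encoded by the set of its entries; the
  empty set plays the role of the index 0 of \<open>i\<^sub>0 = 1\<close>.
\<close>

definition gidx :: "nat set set" where
  "gidx = {\<alpha>. finite \<alpha> \<and> 0 \<notin> \<alpha>}"

typedef grassmann =
  "{f :: nat set \<Rightarrow> complex. (\<forall>\<alpha>. \<alpha> \<notin> gidx \<longrightarrow> f \<alpha> = 0) \<and> (\<lambda>a. norm (f a)) summable_on UNIV}"
  morphisms gcoeff Abs_grassmann
  by (rule exI[of _ "\<lambda>_. 0"]) auto

setup_lifting type_definition_grassmann

lemma coeff_outside: "\<alpha> \<notin> gidx \<Longrightarrow> gcoeff z \<alpha> = 0"
  using gcoeff[of z] by auto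

lemma coeff_summable: "(\<lambda>a. norm (gcoeff z a)) summable_on UNIV"
  using gcoeff[of z] by auto

lemma grassmann_eqI: "(\<And>\<alpha>. gcoeff x \<alpha> = gcoeff y \<alpha>) \<Longrightarrow> x = y"
  by (metis gcoeff_inject ext)

lemma l1_summableI:
  fixes f :: "'a \<Rightarrow> complex"
  assumes "\<And>F. finite F \<Longrightarrow> (\<Sum>a\<in>F. norm (f a)) \<le> K"
  shows "(\<lambda>a. norm (f a)) summable_on UNIV"
  using assms by (intro nonneg_bdd_above_summable_on bdd_aboveI[where M = K]) auto

lemma l1_add:
  fixes f g :: "'a \<Rightarrow> complex"
  assumes "(\<lambda>a. norm (f a)) summable_on A" "(\<lambda>a. norm (g a)) summable_on A"
  shows "(\<lambda>a. norm (f a + g a)) summable_on A"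
  by (rule summable_on_comparison_test[OF summable_on_add[OF assms]])
    (auto intro: norm_triangle_ineq)

lemma l1_le:
  fixes f :: "'a \<Rightarrow> complex"
  assumes "\<And>F. finite F \<Longrightarrow> (\<Sum>a\<in>F. norm (f a)) \<le> K"
  shows "(\<Sum>\<^sub>\<infinity>a. norm (f a)) \<le> K"
  using assms l1_summableI[OF assms] by (intro infsum_le_finite_sums) auto

lemma l1_ge:
  fixes f :: "'a \<Rightarrow> complex"
  assumes "(\<lambda>a. norm (f a)) summable_on UNIV" "finite F"
  shows "(\<Sum>a\<in>F. norm (f a)) \<le> (\<Sum>\<^sub>\<infinity>a. norm (f a))"
  using assms by (intro finite_sum_le_infsum) auto

text \<open>
  The sign in \<open>i\<^sub>\<alpha> i\<^sub>\<beta> = \<plusminus> i\<^sub>\<gamma>\<close>, where \<open>\<alpha>\<close>, \<open>\<beta>\<close> are disjoint with union \<open>\<gamma>\<close>: it is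
  \<open>-1\<close> to the number of transpositions of adjacent generators needed to sort the concatenation of \<open>\<alpha>\<close> and \<open>\<beta>\<close>.
  For \<open>\<alpha>\<close>, \<open>\<beta>\<close> not disjoint the product is 0, so that \<open>\<gamma>\<close>-coefficients of products are
  obtained by summing over the decompositions \<open>\<gamma> = \<alpha> \<union> (\<gamma> - \<alpha>)\<close>
  (for infinite \<open>\<gamma>\<close>, which is not an index, that sum is 0 by convention).
\<close>

definition gsign :: "nat set \<Rightarrow> nat set \<Rightarrow> complex" where
  "gsign \<alpha> \<beta> = (- 1) ^ card {(a, b). a \<in> \<alpha> \<and> b \<in> \<beta> \<and> b < a}"

definition gconv :: "(nat set \<Rightarrow> complex) \<Rightarrow> (nat set \<Rightarrow> complex) \<Rightarrow> nat set \<Rightarrow> complex" where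
  "gconv f g \<gamma> = (\<Sum>\<alpha>\<in>Pow \<gamma>. gsign \<alpha> (\<gamma> - \<alpha>) * f \<alpha> * g (\<gamma> - \<alpha>))"

lemma norm_gsign [simp]: "norm (gsign \<alpha> \<beta>) = 1"
  by (simp add: gsign_def norm_power)

lemma gsign_empty [simp]: "gsign {} \<beta> = 1" "gsign \<alpha> {} = 1"
  by (simp_all add: gsign_def)

lemma finite_inversions:
  "finite \<alpha> \<Longrightarrow> finite \<beta> \<Longrightarrow> finite {(a, b). a \<in> \<alpha> \<and> b \<in> \<beta> \<and> b < (a::nat)}"
  by (rule finite_subset[of _ "\<alpha> \<times> \<beta>"]) auto

lemma gsign_Un_left:
  assumes "finite \<alpha>" "finite \<beta>" "finite \<gamma>" "\<alpha> \<inter> \<beta> = {}"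
  shows "gsign (\<alpha> \<union> \<beta>) \<gamma> = gsign \<alpha> \<gamma> * gsign \<beta> \<gamma>"
proof -
  have "{(a, b). a \<in> \<alpha> \<union> \<beta> \<and> b \<in> \<gamma> \<and> b < a} =
        {(a, b). a \<in> \<alpha> \<and> b \<in> \<gamma> \<and> b < a} \<union> {(a, b). a \<in> \<beta> \<and> b \<in> \<gamma> \<and> b < a}"
    by auto
  moreover have "card \<dots> = card {(a, b). a \<in> \<alpha> \<and> b \<in> \<gamma> \<and> b < a} +
        card {(a, b). a \<in> \<beta> \<and> b \<in> \<gamma> \<and> b < a}"
    using assms by (intro card_Un_disjoint finite_inversions) auto
  ultimately show ?thesis by (simp add: gsign_def power_add)
qed

lemma gsign_Un_right:
  assumes "finite \<alpha>" "finite \<beta>" "finite \<gamma>" "\<beta> \<inter> \<gamma> = {}"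
  shows "gsign \<alpha> (\<beta> \<union> \<gamma>) = gsign \<alpha> \<beta> * gsign \<alpha> \<gamma>"
proof -
  have "{(a, b). a \<in> \<alpha> \<and> b \<in> \<beta> \<union> \<gamma> \<and> b < a} =
        {(a, b). a \<in> \<alpha> \<and> b \<in> \<beta> \<and> b < a} \<union> {(a, b). a \<in> \<alpha> \<and> b \<in> \<gamma> \<and> b < a}"
    by auto
  moreover have "card \<dots> = card {(a, b). a \<in> \<alpha> \<and> b \<in> \<beta> \<and> b < a} +
        card {(a, b). a \<in> \<alpha> \<and> b \<in> \<gamma> \<and> b < a}"
    using assms by (intro card_Un_disjoint finite_inversions) auto
  ultimately show ?thesis by (simp add: gsign_def power_add)
qed

lemma gconv_infinite: "infinite \<gamma> \<Longrightarrow> gconv f g \<gamma> = 0"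
  by (simp add: gconv_def)

lemma gconv_outside:
  assumes "\<And>\<alpha>. \<alpha> \<notin> gidx \<Longrightarrow> f \<alpha> = 0" "\<And>\<alpha>. \<alpha> \<notin> gidx \<Longrightarrow> g \<alpha> = 0" "\<gamma> \<notin> gidx"
  shows "gconv f g \<gamma> = 0"
proof (cases "finite \<gamma>")
  case True
  then have "0 \<in> \<gamma>" using assms(3) by (auto simp: gidx_def)
  have "f \<alpha> = 0 \<or> g (\<gamma> - \<alpha>) = 0" for \<alpha>
    using assms(1)[of \<alpha>] assms(2)[of "\<gamma> - \<alpha>"] \<open>0 \<in> \<gamma>\<close> by (auto simp: gidx_def)
  then show ?thesis unfolding gconv_def by (intro sum.neutral) auto
qed (rule gconv_infinite)

lemma gconv_sum_le:
  assumes "(\<lambda>a. norm (f a)) summable_on UNIV" "(\<lambda>a. norm (g a)) summable_on UNIV" "finite F"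
  shows "(\<Sum>\<gamma>\<in>F. norm (gconv f g \<gamma>)) \<le> (\<Sum>\<^sub>\<infinity>\<alpha>. norm (f \<alpha>)) * (\<Sum>\<^sub>\<infinity>\<alpha>. norm (g \<alpha>))"
proof -
  define F' where "F' = {\<gamma>\<in>F. finite \<gamma>}"
  define S where "S = Sigma F' Pow"
  define h where "h = (\<lambda>(\<gamma>, \<alpha>). (\<alpha> :: nat set, \<gamma> - \<alpha>))"
  have fin: "finite F'" "finite S" using assms(3) by (auto simp: F'_def S_def)
  have inj: "inj_on h S" by (auto simp: inj_on_def h_def S_def)
  have "(\<Sum>\<gamma>\<in>F. norm (gconv f g \<gamma>)) = (\<Sum>\<gamma>\<in>F'. norm (gconv f g \<gamma>))"
    using assms(3) unfolding F'_def by (intro sum.mono_neutral_right) (auto simp: gconv_infinite)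
  also have "\<dots> \<le> (\<Sum>\<gamma>\<in>F'. \<Sum>\<alpha>\<in>Pow \<gamma>. norm (f \<alpha>) * norm (g (\<gamma> - \<alpha>)))"
    unfolding gconv_def by (intro sum_mono sum_norm_le) (simp add: norm_mult)
  also have "\<dots> = (\<Sum>(\<gamma>, \<alpha>)\<in>S. norm (f \<alpha>) * norm (g (\<gamma> - \<alpha>)))"
    unfolding S_def using fin by (intro sum.Sigma) (auto simp: F'_def)
  also have "\<dots> = (\<Sum>(\<alpha>, \<beta>)\<in>h ` S. norm (f \<alpha>) * norm (g \<beta>))"
    by (subst sum.reindex[OF inj]) (auto simp: h_def intro!: sum.cong)
  also have "\<dots> \<le> (\<Sum>(\<alpha>, \<beta>)\<in>(fst ` h ` S) \<times> (snd ` h ` S). norm (f \<alpha>) * norm (g \<beta>))"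
    using fin by (intro sum_mono2 finite_cartesian_product finite_imageI subsetI) (auto simp: mem_Times_iff)
  also have "\<dots> = (\<Sum>\<alpha>\<in>fst ` h ` S. norm (f \<alpha>)) * (\<Sum>\<beta>\<in>snd ` h ` S. norm (g \<beta>))"
    by (simp add: sum_product sum.cartesian_product)
  also have "\<dots> \<le> (\<Sum>\<^sub>\<infinity>\<alpha>. norm (f \<alpha>)) * (\<Sum>\<^sub>\<infinity>\<alpha>. norm (g \<alpha>))"
    using fin assms by (intro mult_mono l1_ge infsum_nonneg sum_nonneg) auto
  finally show ?thesis .
qed

lemma gconv_assoc: "gconv (gconv f g) h = gconv f (gconv g h)"
proof
  fix \<gamma>
  show "gconv (gconv f g) h \<gamma> = gconv f (gconv g h) \<gamma>"
  proof (cases "finite \<gamma>")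
    case True
    have fin: "finite \<delta>" if "\<delta> \<subseteq> \<gamma>" for \<delta> using that True finite_subset by blast
    have "gconv (gconv f g) h \<gamma> =
      (\<Sum>(\<beta>, \<alpha>)\<in>Sigma (Pow \<gamma>) Pow.
        gsign \<beta> (\<gamma> - \<beta>) * gsign \<alpha> (\<beta> - \<alpha>) * f \<alpha> * g (\<beta> - \<alpha>) * h (\<gamma> - \<beta>))"
      unfolding gconv_def sum_distrib_left sum_distrib_right
      using True fin by (subst sum.Sigma) (auto intro!: sum.cong simp: mult_ac)
    also have "\<dots> = (\<Sum>(\<alpha>, \<delta>)\<in>Sigma (Pow \<gamma>) (\<lambda>\<alpha>. Pow (\<gamma> - \<alpha>)).
        gsign \<alpha> (\<gamma> - \<alpha>) * gsign \<delta> (\<gamma> - \<alpha> - \<delta>) * f \<alpha> * g \<delta> * h (\<gamma> - \<alpha> - \<delta>))"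
    proof (rule sum.reindex_bij_witness[where i = "\<lambda>(\<alpha>, \<delta>). (\<alpha> \<union> \<delta>, \<alpha>)"
          and j = "\<lambda>(\<beta>, \<alpha>). (\<alpha>, \<beta> - \<alpha>)"], goal_cases)
      case (5 p)
      then obtain \<beta> \<alpha> where p: "p = (\<beta>, \<alpha>)" "\<beta> \<subseteq> \<gamma>" "\<alpha> \<subseteq> \<beta>" by auto
      have eqs: "\<gamma> - \<alpha> = (\<beta> - \<alpha>) \<union> (\<gamma> - \<beta>)" "\<gamma> - \<alpha> - (\<beta> - \<alpha>) = \<gamma> - \<beta>"
        "\<beta> = \<alpha> \<union> (\<beta> - \<alpha>)"
        using p by auto
      have f: "finite \<alpha>" "finite (\<beta> - \<alpha>)" "finite (\<gamma> - \<beta>)" using p fin by auto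
      have "gsign \<beta> (\<gamma> - \<beta>) = gsign \<alpha> (\<gamma> - \<beta>) * gsign (\<beta> - \<alpha>) (\<gamma> - \<beta>)"
        using gsign_Un_left[of \<alpha> "\<beta> - \<alpha>" "\<gamma> - \<beta>"] f eqs(3) by auto
      moreover have "gsign \<alpha> (\<gamma> - \<alpha>) = gsign \<alpha> (\<beta> - \<alpha>) * gsign \<alpha> (\<gamma> - \<beta>)"
        unfolding eqs(1) using f by (intro gsign_Un_right) auto
      ultimately show ?case using p eqs(2) by (simp add: mult_ac)
    qed auto
    also have "\<dots> = gconv f (gconv g h) \<gamma>"
      unfolding gconv_def sum_distrib_left sum_distrib_right
      using True fin by (subst sum.Sigma) (auto intro!: sum.cong simp: mult_ac)
    finally show ?thesis .
  qed (simp add: gconv_infinite)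
qed

lemma gconv_add_left: "gconv (\<lambda>\<alpha>. f \<alpha> + g \<alpha>) h \<gamma> = gconv f h \<gamma> + gconv g h \<gamma>"
  by (simp add: gconv_def algebra_simps sum.distrib)

lemma gconv_add_right: "gconv f (\<lambda>\<alpha>. g \<alpha> + h \<alpha>) \<gamma> = gconv f g \<gamma> + gconv f h \<gamma>"
  by (simp add: gconv_def algebra_simps sum.distrib)

lemma gconv_scale_left: "gconv (\<lambda>\<alpha>. c * f \<alpha>) g \<gamma> = c * gconv f g \<gamma>"
  by (simp add: gconv_def sum_distrib_left mult_ac)

lemma gconv_scale_right: "gconv f (\<lambda>\<alpha>. c * g \<alpha>) \<gamma> = c * gconv f g \<gamma>"
  by (simp add: gconv_def sum_distrib_left mult_ac)

lemma gconv_one_left: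
  assumes "\<And>\<alpha>. \<alpha> \<notin> gidx \<Longrightarrow> f \<alpha> = 0"
  shows "gconv (\<lambda>\<alpha>. if \<alpha> = {} then 1 else 0) f \<gamma> = f \<gamma>"
proof (cases "finite \<gamma>")
  case True
  have "gconv (\<lambda>\<alpha>. if \<alpha> = {} then 1 else 0) f \<gamma> = (\<Sum>\<alpha>\<in>Pow \<gamma>. if \<alpha> = {} then f \<gamma> else 0)"
    unfolding gconv_def by (intro sum.cong) auto
  then show ?thesis using True by (subst (asm) sum.delta) auto
qed (use assms[of \<gamma>] in \<open>auto simp: gconv_infinite gidx_def\<close>)

lemma gconv_one_right:
  assumes "\<And>\<alpha>. \<alpha> \<notin> gidx \<Longrightarrow> f \<alpha> = 0"
  shows "gconv f (\<lambda>\<alpha>. if \<alpha> = {} then 1 else 0) \<gamma> = f \<gamma>"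
proof (cases "finite \<gamma>")
  case True
  have "gconv f (\<lambda>\<alpha>. if \<alpha> = {} then 1 else 0) \<gamma> = (\<Sum>\<alpha>\<in>Pow \<gamma>. if \<alpha> = \<gamma> then f \<gamma> else 0)"
    unfolding gconv_def by (intro sum.cong) auto
  then show ?thesis using True by (subst (asm) sum.delta) auto
qed (use assms[of \<gamma>] in \<open>auto simp: gconv_infinite gidx_def\<close>)

lift_definition scaleC :: "complex \<Rightarrow> grassmann \<Rightarrow> grassmann" is "\<lambda>c f \<alpha>. c * f \<alpha>"
  by (auto simp: norm_mult intro: summable_on_cmult_right)

instantiation grassmann :: real_normed_algebra_1
begin

lift_definition zero_grassmann :: grassmann is "\<lambda>_. 0" by auto

lift_definition one_grassmann :: grassmann is "\<lambda>\<alpha>. if \<alpha> = {} then 1 else 0"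
proof -
  have "(\<lambda>\<alpha>::nat set. norm (if \<alpha> = {} then 1 else 0 :: complex)) summable_on UNIV"
    by (rule finite_nonzero_values_imp_summable_on, rule finite_subset[of _ "{{}}"]) auto
  then show "(\<forall>\<alpha>. \<alpha> \<notin> gidx \<longrightarrow> (if \<alpha> = {} then 1 else 0) = (0::complex)) \<and>
     (\<lambda>\<alpha>::nat set. norm (if \<alpha> = {} then 1 else 0 :: complex)) summable_on UNIV"
    by (auto simp: gidx_def)
qed

lift_definition plus_grassmann :: "grassmann \<Rightarrow> grassmann \<Rightarrow> grassmann" is "\<lambda>f g \<alpha>. f \<alpha> + g \<alpha>"
  by (auto intro: l1_add)

lift_definition uminus_grassmann :: "grassmann \<Rightarrow> grassmann" is "\<lambda>f \<alpha>. - f \<alpha>" by auto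

definition minus_grassmann :: "grassmann \<Rightarrow> grassmann \<Rightarrow> grassmann" where
  "minus_grassmann x y = x + (- y)"

lift_definition times_grassmann :: "grassmann \<Rightarrow> grassmann \<Rightarrow> grassmann" is gconv
  by (intro conjI allI impI gconv_outside l1_summableI[OF gconv_sum_le]) auto

definition scaleR_grassmann :: "real \<Rightarrow> grassmann \<Rightarrow> grassmann" where
  "scaleR_grassmann r x = scaleC (complex_of_real r) x"

definition norm_grassmann :: "grassmann \<Rightarrow> real" where
  "norm_grassmann z = (\<Sum>\<^sub>\<infinity>\<alpha>. cmod (gcoeff z \<alpha>))"

definition sgn_grassmann :: "grassmann \<Rightarrow> grassmann" where
  "sgn_grassmann x = inverse (norm x) *\<^sub>R x"

definition dist_grassmann :: "grassmann \<Rightarrow> grassmann \<Rightarrow> real" where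
  "dist_grassmann x y = norm (x - y)"

definition uniformity_grassmann :: "(grassmann \<times> grassmann) filter" where
  "uniformity_grassmann = (INF e\<in>{0<..}. principal {(x, y). dist x y < e})"

definition open_grassmann :: "grassmann set \<Rightarrow> bool" where
  "open_grassmann U \<longleftrightarrow> (\<forall>x\<in>U. \<forall>\<^sub>F (x', y) in uniformity. x' = x \<longrightarrow> y \<in> U)"

lemma coeff_minus': "gcoeff (x - y) \<alpha> = gcoeff x \<alpha> - gcoeff y \<alpha>"
  by (simp add: minus_grassmann_def plus_grassmann.rep_eq uminus_grassmann.rep_eq)

lemmas coeff_rep_eqs = zero_grassmann.rep_eq one_grassmann.rep_eq plus_grassmann.rep_eq
  uminus_grassmann.rep_eq times_grassmann.rep_eq scaleC.rep_eq coeff_minus'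

lemma coeff_le_norm': "cmod (gcoeff x \<alpha>) \<le> norm x"
  using l1_ge[OF coeff_summable, of "{\<alpha>}" x] by (simp add: norm_grassmann_def)

instance
proof
  fix x y z :: grassmann and a b :: real
  show "x + y + z = x + (y + z)" "x + y = y + x" "0 + x = x" "- x + x = 0"
    "x - y = x + - y"
    by (auto intro!: grassmann_eqI simp: coeff_rep_eqs)
  show "a *\<^sub>R (x + y) = a *\<^sub>R x + a *\<^sub>R y" "(a + b) *\<^sub>R x = a *\<^sub>R x + b *\<^sub>R x"
    "a *\<^sub>R b *\<^sub>R x = (a * b) *\<^sub>R x" "1 *\<^sub>R x = x"
    by (auto intro!: grassmann_eqI simp: coeff_rep_eqs scaleR_grassmann_def algebra_simps)
  show "x * y * z = x * (y * z)"
    by (rule grassmann_eqI) (simp add: coeff_rep_eqs gconv_assoc)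
  show "(x + y) * z = x * z + y * z"
    by (rule grassmann_eqI)
      (simp add: times_grassmann.rep_eq plus_grassmann.rep_eq gconv_add_left[symmetric]
        plus_grassmann.rep_eq[abs_def])
  show "x * (y + z) = x * y + x * z"
    by (rule grassmann_eqI)
      (simp add: times_grassmann.rep_eq plus_grassmann.rep_eq gconv_add_right[symmetric]
        plus_grassmann.rep_eq[abs_def])
  show "a *\<^sub>R x * y = a *\<^sub>R (x * y)" "x * a *\<^sub>R y = a *\<^sub>R (x * y)"
    by (auto intro!: grassmann_eqI
        simp: coeff_rep_eqs scaleR_grassmann_def gconv_scale_left gconv_scale_right)
  show "1 * x = x" "x * 1 = x"
    by (auto intro!: grassmann_eqI
        simp: coeff_rep_eqs gconv_one_left gconv_one_right coeff_outside)
  have "gcoeff 0 {} \<noteq> gcoeff 1 {}" by (simp add: coeff_rep_eqs)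
  then show "0 \<noteq> (1 :: grassmann)" by metis
  show "dist x y = norm (x - y)" by (rule dist_grassmann_def)
  show "sgn x = inverse (norm x) *\<^sub>R x" by (rule sgn_grassmann_def)
  show "uniformity = (INF e\<in>{0<..}. principal {(x, y :: grassmann). dist x y < e})"
    by (rule uniformity_grassmann_def)
  show "open U \<longleftrightarrow> (\<forall>x\<in>U. \<forall>\<^sub>F (x', y) in uniformity. x' = x \<longrightarrow> y \<in> U)"
    for U :: "grassmann set"
    by (rule open_grassmann_def)
  show "norm x = 0 \<longleftrightarrow> x = 0"
  proof
    assume "norm x = 0"
    then have "gcoeff x \<alpha> = 0" for \<alpha> using coeff_le_norm'[of x \<alpha>] by simp
    then show "x = 0" by (intro grassmann_eqI) (simp add: coeff_rep_eqs)
  qed (simp add: norm_grassmann_def coeff_rep_eqs)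
  show "norm (x + y) \<le> norm x + norm y"
    unfolding norm_grassmann_def
  proof (rule l1_le)
    fix F :: "nat set set" assume "finite F"
    have "(\<Sum>\<alpha>\<in>F. cmod (gcoeff (x + y) \<alpha>)) \<le> (\<Sum>\<alpha>\<in>F. cmod (gcoeff x \<alpha>)) + (\<Sum>\<alpha>\<in>F. cmod (gcoeff y \<alpha>))"
      by (simp add: coeff_rep_eqs sum.distrib[symmetric] sum_mono norm_triangle_ineq)
    also have "\<dots> \<le> (\<Sum>\<^sub>\<infinity>\<alpha>. cmod (gcoeff x \<alpha>)) + (\<Sum>\<^sub>\<infinity>\<alpha>. cmod (gcoeff y \<alpha>))"
      using \<open>finite F\<close> by (intro add_mono l1_ge coeff_summable)
    finally show "(\<Sum>\<alpha>\<in>F. cmod (gcoeff (x + y) \<alpha>)) \<le>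
      (\<Sum>\<^sub>\<infinity>\<alpha>. cmod (gcoeff x \<alpha>)) + (\<Sum>\<^sub>\<infinity>\<alpha>. cmod (gcoeff y \<alpha>))" .
  qed
  show "norm (a *\<^sub>R x) = \<bar>a\<bar> * norm x"
    using coeff_summable[of x]
    by (simp add: norm_grassmann_def scaleR_grassmann_def coeff_rep_eqs norm_mult
        infsum_cmult_right)
  show "norm (x * y) \<le> norm x * norm y"
    unfolding norm_grassmann_def times_grassmann.rep_eq
    by (intro l1_le gconv_sum_le coeff_summable)
  have "(\<Sum>\<^sub>\<infinity>\<alpha>. cmod (gcoeff 1 \<alpha>)) = (\<Sum>\<^sub>\<infinity>\<alpha>\<in>{{}}. cmod (gcoeff 1 \<alpha>))"
    by (rule infsum_cong_neutral) (auto simp: coeff_rep_eqs)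
  then show "norm (1 :: grassmann) = 1"
    by (simp add: norm_grassmann_def coeff_rep_eqs)
qed

end

lemmas coeff_simps [simp] = zero_grassmann.rep_eq one_grassmann.rep_eq plus_grassmann.rep_eq
  uminus_grassmann.rep_eq scaleC.rep_eq coeff_minus'

lemmas coeff_times = times_grassmann.rep_eq
lemmas coeff_le_norm = coeff_le_norm'

lemma coeff_scaleR [simp]: "gcoeff (a *\<^sub>R x) \<alpha> = of_real a * gcoeff x \<alpha>"
  by (simp add: scaleR_grassmann_def)

lemma coeff_sum: "gcoeff (sum f S) \<alpha> = (\<Sum>s\<in>S. gcoeff (f s) \<alpha>)"
  by (induction S rule: infinite_finite_induct) auto

lemma norm_scaleC: "norm (scaleC c x) = cmod c * norm x"
  using coeff_summable[of x] by (simp add: norm_grassmann_def norm_mult infsum_cmult_right)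

lemma scaleC_mult: "scaleC c x * y = scaleC c (x * y)" "x * scaleC c y = scaleC c (x * y)"
  by (auto intro!: grassmann_eqI simp: coeff_times gconv_scale_left gconv_scale_right)

instance grassmann :: banach
proof
  fix X :: "nat \<Rightarrow> grassmann" assume X: "Cauchy X"
  have "Cauchy (\<lambda>n. gcoeff (X n) \<alpha>)" for \<alpha>
  proof (rule metric_CauchyI)
    fix e :: real assume "e > 0"
    with X obtain M where M: "\<And>m n. m \<ge> M \<Longrightarrow> n \<ge> M \<Longrightarrow> dist (X m) (X n) < e"
      unfolding Cauchy_def by blast
    have "dist (gcoeff (X m) \<alpha>) (gcoeff (X n) \<alpha>) \<le> dist (X m) (X n)" for m n
      using coeff_le_norm[of "X m - X n" \<alpha>] by (simp add: dist_norm)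
    with M show "\<exists>M. \<forall>m\<ge>M. \<forall>n\<ge>M. dist (gcoeff (X m) \<alpha>) (gcoeff (X n) \<alpha>) < e"
      by (meson le_less_trans)
  qed
  then have "\<exists>l. (\<lambda>n. gcoeff (X n) \<alpha>) \<longlonglongrightarrow> l" for \<alpha>
    by (simp add: Cauchy_convergent_iff convergent_def)
  then obtain f where f: "\<And>\<alpha>. (\<lambda>n. gcoeff (X n) \<alpha>) \<longlonglongrightarrow> f \<alpha>" by metis
  have tail: "\<exists>M. \<forall>n\<ge>M. \<forall>F. finite F \<longrightarrow> (\<Sum>\<alpha>\<in>F. cmod (gcoeff (X n) \<alpha> - f \<alpha>)) \<le> e"
    if "e > 0" for e
  proof -
    from X that obtain M where M: "\<And>m n. m \<ge> M \<Longrightarrow> n \<ge> M \<Longrightarrow> dist (X m) (X n) < e"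
      unfolding Cauchy_def by blast
    have "(\<Sum>\<alpha>\<in>F. cmod (gcoeff (X n) \<alpha> - f \<alpha>)) \<le> e" if "n \<ge> M" "finite F" for n F
    proof (rule LIMSEQ_le_const2)
      show "(\<lambda>m. \<Sum>\<alpha>\<in>F. cmod (gcoeff (X n) \<alpha> - gcoeff (X m) \<alpha>)) \<longlonglongrightarrow>
        (\<Sum>\<alpha>\<in>F. cmod (gcoeff (X n) \<alpha> - f \<alpha>))"
        by (intro tendsto_intros f)
      have "(\<Sum>\<alpha>\<in>F. cmod (gcoeff (X n) \<alpha> - gcoeff (X m) \<alpha>)) \<le> e" if "m \<ge> M" for m
        using l1_ge[OF coeff_summable[of "X n - X m"] \<open>finite F\<close>] M[OF \<open>n \<ge> M\<close> that]
        by (simp add: dist_norm norm_grassmann_def)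
      then show "\<exists>N. \<forall>m\<ge>N. (\<Sum>\<alpha>\<in>F. cmod (gcoeff (X n) \<alpha> - gcoeff (X m) \<alpha>)) \<le> e" by blast
    qed
    then show ?thesis by blast
  qed
  have out: "f \<alpha> = 0" if "\<alpha> \<notin> gidx" for \<alpha>
    using f[of \<alpha>] coeff_outside[OF that] by (simp add: LIMSEQ_const_iff)
  from tail[of 1] obtain M where
    "\<And>F. finite F \<Longrightarrow> (\<Sum>\<alpha>\<in>F. cmod (gcoeff (X M) \<alpha> - f \<alpha>)) \<le> 1" by auto
  then have "(\<lambda>\<alpha>. norm (gcoeff (X M) \<alpha> - f \<alpha>)) summable_on UNIV" by (rule l1_summableI)
  then have "(\<lambda>\<alpha>. norm (- (gcoeff (X M) \<alpha> - f \<alpha>))) summable_on UNIV"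
    by (simp only: norm_minus_cancel)
  from l1_add[OF coeff_summable[of "X M"] this]
  have "(\<lambda>a. norm (f a)) summable_on UNIV" by simp
  with out have cf: "gcoeff (Abs_grassmann f) = f" by (intro Abs_grassmann_inverse) auto
  have "X \<longlonglongrightarrow> Abs_grassmann f"
  proof (rule metric_LIMSEQ_I)
    fix e :: real assume "e > 0"
    then obtain M where M: "\<And>n F. n \<ge> M \<Longrightarrow> finite F \<Longrightarrow>
      (\<Sum>\<alpha>\<in>F. cmod (gcoeff (X n) \<alpha> - f \<alpha>)) \<le> e / 2"
      using tail[of "e / 2"] by auto
    have "dist (X n) (Abs_grassmann f) \<le> e / 2" if "n \<ge> M" for n
      using l1_le[of "\<lambda>\<alpha>. gcoeff (X n) \<alpha> - f \<alpha>", OF M[OF that]]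
      by (simp add: dist_norm norm_grassmann_def cf)
    with \<open>e > 0\<close> show "\<exists>M. \<forall>n\<ge>M. dist (X n) (Abs_grassmann f) < e"
      by (intro exI[of _ M]) fastforce
  qed
  then show "convergent X" by (auto simp: convergent_def)
qed

text \<open>The generators are \<open>gen n\<close> for \<open>n \<ge> 1\<close>; the value \<open>gen 0 = 0\<close> is a dummy.\<close>

lift_definition gen :: "nat \<Rightarrow> grassmann" is "\<lambda>n \<alpha>. if n \<ge> 1 \<and> \<alpha> = {n} then 1 else 0"
proof -
  fix n :: nat
  have "(\<lambda>\<alpha>. norm (if n \<ge> 1 \<and> \<alpha> = {n} then 1 else 0 :: complex)) summable_on UNIV"
    by (rule finite_nonzero_values_imp_summable_on, rule finite_subset[of _ "{{n}}"]) auto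
  then show "(\<forall>\<alpha>. \<alpha> \<notin> gidx \<longrightarrow> (if n \<ge> 1 \<and> \<alpha> = {n} then 1 else 0) = (0::complex)) \<and>
     (\<lambda>\<alpha>. norm (if n \<ge> 1 \<and> \<alpha> = {n} then 1 else 0 :: complex)) summable_on UNIV"
    by (auto simp: gidx_def)
qed

definition gmon :: "nat set \<Rightarrow> grassmann" where
  "gmon \<alpha> = prod_list (map gen (sorted_list_of_set \<alpha>))"

definition Lambda :: "grassmann set" where
  "Lambda = {z. finite {\<alpha>. gcoeff z \<alpha> \<noteq> 0}}"

definition body :: "grassmann \<Rightarrow> complex" where
  "body z = gcoeff z {}"

text \<open>
  The following facts confirm that the product above is the one determined by the
  anticommutation relations, that the \<open>gmon \<alpha>\<close> form a basis of \<open>Lambda\<close>, and that the Banach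
  algebra \<^typ>\<open>grassmann\<close> is the completion of \<open>Lambda\<close>.
\<close>

lemma coeff_gen_times:
  assumes "n \<ge> 1"
  shows "gcoeff (gen n * x) \<gamma> =
    (if finite \<gamma> \<and> n \<in> \<gamma> then gsign {n} (\<gamma> - {n}) * gcoeff x (\<gamma> - {n}) else 0)"
proof (cases "finite \<gamma>")
  case True
  have "gcoeff (gen n * x) \<gamma> = (\<Sum>\<alpha>\<in>Pow \<gamma>.
      if \<alpha> = {n} then gsign {n} (\<gamma> - {n}) * gcoeff x (\<gamma> - {n}) else 0)"
    unfolding coeff_times gconv_def using assms by (intro sum.cong) (auto simp: gen.rep_eq)
  then show ?thesis using True by (subst (asm) sum.delta) auto
qed (simp add: coeff_times gconv_infinite)

lemma gen_anticommute: "gen n * gen m + gen m * gen n = 0"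
proof (cases "n \<ge> 1 \<and> m \<ge> 1")
  case True
  have sing: "gsign {a} {b} = (if b < a then - 1 else 1)" for a b
  proof -
    have "{(x, y). x \<in> {a} \<and> y \<in> {b} \<and> y < x} = (if b < a then {(a, b)} else {})" by auto
    then show ?thesis by (simp add: gsign_def)
  qed
  show ?thesis
  proof (cases "n = m")
    case nm: True
    then show ?thesis
      using True by (intro grassmann_eqI) (auto simp: coeff_gen_times gen.rep_eq)
  next
    case nm: False
    have *: "(finite \<gamma> \<and> a \<in> \<gamma> \<and> \<gamma> - {a} = {b}) \<longleftrightarrow> \<gamma> = {a, b}" if "a \<noteq> b" for a b :: nat and \<gamma>
      using that by (auto dest: finite_subset)
    have co: "gcoeff (gen a * gen b) \<gamma> = (if \<gamma> = {a, b} then gsign {a} {b} else 0)"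
      if "a \<noteq> b" "a \<ge> 1" "b \<ge> 1" for a b \<gamma>
      using *[OF that(1), of \<gamma>] that by (auto simp: coeff_gen_times gen.rep_eq)
    show ?thesis
      using True nm by (intro grassmann_eqI) (auto simp: co sing insert_commute)
  qed
next
  case False
  have "gen 0 = 0" by (rule grassmann_eqI) (simp add: gen.rep_eq)
  with False show ?thesis by (cases n; cases m) auto
qed

lemma coeff_gmon:
  assumes "\<alpha> \<in> gidx"
  shows "gcoeff (gmon \<alpha>) \<gamma> = (if \<gamma> = \<alpha> then 1 else 0)"
proof -
  have "gcoeff (prod_list (map gen xs)) \<gamma> = (if \<gamma> = set xs then 1 else 0)"
    if "sorted_wrt (<) xs" "0 \<notin> set xs" for xs :: "nat list" and \<gamma>
    using that
  proof (induction xs arbitrary: \<gamma>)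
    case (Cons a xs)
    have "{(x, y). x \<in> {a} \<and> y \<in> set xs \<and> y < x} = {}" using Cons.prems by auto
    then have s: "gsign {a} (set xs) = 1" unfolding gsign_def by (metis card.empty power_0)
    have a: "a \<notin> set xs" "a \<ge> 1" using Cons.prems by auto
    have eq: "(finite \<gamma> \<and> a \<in> \<gamma> \<and> \<gamma> - {a} = set xs) \<longleftrightarrow> \<gamma> = insert a (set xs)"
      using a by (auto intro: finite_subset)
    have "gcoeff (prod_list (map gen xs)) \<delta> = (if \<delta> = set xs then 1 else 0)" for \<delta>
      using Cons by auto
    then show ?case using eq s a by (auto simp: coeff_gen_times)
  qed auto
  from this[of "sorted_list_of_set \<alpha>"] assms show ?thesis
    by (simp add: gmon_def gidx_def)
qed

lemma gmon_empty: "gmon {} = 1"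
  by (simp add: gmon_def)

lemma Lambda_expansion:
  assumes "z \<in> Lambda"
  shows "z = (\<Sum>\<alpha> | gcoeff z \<alpha> \<noteq> 0. scaleC (gcoeff z \<alpha>) (gmon \<alpha>))"
proof (rule grassmann_eqI)
  fix \<gamma>
  have "(\<Sum>\<alpha> | gcoeff z \<alpha> \<noteq> 0. gcoeff (scaleC (gcoeff z \<alpha>) (gmon \<alpha>)) \<gamma>) =
    (\<Sum>\<alpha> | gcoeff z \<alpha> \<noteq> 0. if \<alpha> = \<gamma> then gcoeff z \<gamma> else 0)"
    proof (intro sum.cong refl)
    fix \<alpha> assume "\<alpha> \<in> {\<alpha>. gcoeff z \<alpha> \<noteq> 0}"
    then have "\<alpha> \<in> gidx" using coeff_outside by blast
    then show "gcoeff (scaleC (gcoeff z \<alpha>) (gmon \<alpha>)) \<gamma> = (if \<alpha> = \<gamma> then gcoeff z \<gamma> else 0)"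
      by (auto simp: coeff_gmon)
  qed
  also have "\<dots> = gcoeff z \<gamma>"
    using assms by (subst sum.delta) (auto simp: Lambda_def)
  finally show "gcoeff z \<gamma> = gcoeff (\<Sum>\<alpha> | gcoeff z \<alpha> \<noteq> 0. scaleC (gcoeff z \<alpha>) (gmon \<alpha>)) \<gamma>"
    by (simp add: coeff_sum)
qed

lemma grassmann_has_sum: "((\<lambda>\<alpha>. scaleC (gcoeff z \<alpha>) (gmon \<alpha>)) has_sum z) gidx"
proof -
  have "eventually (\<lambda>F. dist (\<Sum>\<alpha>\<in>F. scaleC (gcoeff z \<alpha>) (gmon \<alpha>)) z < e)
      (finite_subsets_at_top gidx)" if "e > 0" for e
  proof -
    have sm: "(\<lambda>\<alpha>. cmod (gcoeff z \<alpha>)) summable_on UNIV" by (rule coeff_summable)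
    then have "((\<lambda>\<alpha>. cmod (gcoeff z \<alpha>)) has_sum norm z) UNIV"
      by (simp add: norm_grassmann_def has_sum_infsum)
    then have "((\<lambda>\<alpha>. cmod (gcoeff z \<alpha>)) has_sum norm z) gidx"
      by (rule has_sum_cong_neutral[THEN iffD1, rotated -1]) (auto simp: coeff_outside)
    then have "eventually (\<lambda>F. dist (\<Sum>\<alpha>\<in>F. cmod (gcoeff z \<alpha>)) (norm z) < e)
      (finite_subsets_at_top gidx)"
      using that by (simp add: has_sum_def tendsto_iff)
    moreover have "eventually (\<lambda>F. finite F \<and> F \<subseteq> gidx) (finite_subsets_at_top gidx)"
      by (rule eventually_finite_subsets_at_top_weakI) auto
    ultimately show ?thesis
    proof eventually_elim
      case (elim F)
      define r where "r = (\<Sum>\<alpha>\<in>F. scaleC (gcoeff z \<alpha>) (gmon \<alpha>)) - z"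
      have r: "gcoeff r \<gamma> = (if \<gamma> \<in> F then 0 else - gcoeff z \<gamma>)" for \<gamma>
      proof -
        have "(\<Sum>\<alpha>\<in>F. gcoeff z \<alpha> * gcoeff (gmon \<alpha>) \<gamma>) = (\<Sum>\<alpha>\<in>F. if \<alpha> = \<gamma> then gcoeff z \<gamma> else 0)"
          using elim by (intro sum.cong) (auto simp: coeff_gmon subset_iff)
        then show ?thesis using elim by (simp add: r_def coeff_sum)
      qed
      have "norm r = (\<Sum>\<^sub>\<infinity>\<alpha>\<in>UNIV - F. cmod (gcoeff z \<alpha>))"
        unfolding norm_grassmann_def by (rule infsum_cong_neutral) (auto simp: r)
      also have "\<dots> = norm z - (\<Sum>\<alpha>\<in>F. cmod (gcoeff z \<alpha>))"
        using sm elim by (subst infsum_Diff) (auto simp: norm_grassmann_def)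
      finally show ?case using elim by (simp add: dist_norm r_def)
    qed
  qed
  then show ?thesis by (simp add: has_sum_def tendsto_iff)
qed

lemma Lambda_dense: "closure Lambda = UNIV"
proof -
  have "z \<in> closure Lambda" for z
  proof (rule Lim_in_closed_set[OF closed_closure])
    show "((\<lambda>F. \<Sum>\<alpha>\<in>F. scaleC (gcoeff z \<alpha>) (gmon \<alpha>)) \<longlongrightarrow> z) (finite_subsets_at_top gidx)"
      using grassmann_has_sum[of z] by (simp add: has_sum_def)
    have "(\<Sum>\<alpha>\<in>F. scaleC (gcoeff z \<alpha>) (gmon \<alpha>)) \<in> Lambda" if "finite F" "F \<subseteq> gidx" for F
    proof -
      have "{\<gamma>. gcoeff (\<Sum>\<alpha>\<in>F. scaleC (gcoeff z \<alpha>) (gmon \<alpha>)) \<gamma> \<noteq> 0} \<subseteq> F"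
      proof safe
        fix \<gamma> assume nz: "gcoeff (\<Sum>\<alpha>\<in>F. scaleC (gcoeff z \<alpha>) (gmon \<alpha>)) \<gamma> \<noteq> 0"
        show "\<gamma> \<in> F"
        proof (rule ccontr)
          assume "\<gamma> \<notin> F"
          then have "(\<Sum>\<alpha>\<in>F. gcoeff z \<alpha> * gcoeff (gmon \<alpha>) \<gamma>) = 0"
            using that by (intro sum.neutral) (auto simp: coeff_gmon subset_iff)
          with nz show False by (simp add: coeff_sum)
        qed
      qed
      then show ?thesis using that finite_subset by (auto simp: Lambda_def)
    qed
    then show "\<forall>\<^sub>F F in finite_subsets_at_top gidx.
        (\<Sum>\<alpha>\<in>F. scaleC (gcoeff z \<alpha>) (gmon \<alpha>)) \<in> closure Lambda"
      by (intro eventually_finite_subsets_at_top_weakI) (auto intro: closure_subset[THEN subsetD])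
  qed simp
  then show ?thesis by auto
qed

end

theory Submission
  imports Defs
begin

text \<open>
  Scale \<open>z\<close> to have body 1 and write \<open>z = 1 - p - r\<close> with \<open>p\<close> a finite combination of the
  \<open>i\<^sub>\<alpha>\<close>, \<open>\<alpha> \<noteq> 0\<close>, and \<open>\<parallel>r\<parallel> < 1\<close>. The inverse \<open>v\<close> of \<open>1 - r\<close> is a geometric series, and
  \<open>z = (1 - r) (1 - v p)\<close>. The element \<open>v p\<close> lies in the ideal generated by the finitely many
  generators occurring in \<open>p\<close>; this ideal is nilpotent since each generator
  occurs at most once in an \<open>i\<^sub>\<alpha>\<close>. So \<open>1 - v p\<close> is inverted by a finite geometric series.
\<close>

definition invertible_elem :: "'a::monoid_mult \<Rightarrow> bool" where
  "invertible_elem x \<longleftrightarrow> (\<exists>y. x * y = 1 \<and> y * x = 1)"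

lemma invertible_elem_mult:
  assumes "invertible_elem x" "invertible_elem y"
  shows "invertible_elem (x * y)"
proof -
  obtain a b where "x * a = 1" "a * x = 1" "y * b = 1" "b * y = 1"
    using assms by (auto simp: invertible_elem_def)
  then have "x * y * (b * a) = 1" "b * a * (x * y) = 1"
    by (metis mult.assoc mult_1_right)+
  then show ?thesis by (auto simp: invertible_elem_def)
qed

text \<open>Assuming summability instead of \<open>norm x < 1\<close> lets the lemma cover both a
  small element and a nilpotent one of arbitrary norm.\<close>

lemma invertible_elem_one_minus:
  fixes x :: "'a::real_normed_algebra_1"
  assumes "summable (\<lambda>n. x ^ n)"
  shows "invertible_elem (1 - x)"
proof -
  define S where "S = (\<Sum>n. x ^ n)"
  have S: "S = 1 + (\<Sum>n. x ^ Suc n)"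
    unfolding S_def using suminf_split_head[OF assms] by simp
  have "(\<Sum>n. x ^ Suc n) = x * S"
    unfolding S_def using suminf_mult[OF assms] by simp
  moreover have "(\<Sum>n. x ^ Suc n) = S * x"
    unfolding S_def power_Suc2 using suminf_mult2[OF assms] by simp
  ultimately have "(1 - x) * S = 1" "S * (1 - x) = 1"
    using S by (simp_all add: algebra_simps)
  then show ?thesis by (auto simp: invertible_elem_def)
qed

text \<open>For finite \<open>A\<close>, this is the \<open>k\<close>-th power of the ideal generated by the \<open>i\<^sub>a\<close>, \<open>a \<in> A\<close>.\<close>

definition gen_filtration :: "nat set \<Rightarrow> nat \<Rightarrow> grassmann set" where
  "gen_filtration A k = {x. \<forall>\<gamma>. gcoeff x \<gamma> \<noteq> 0 \<longrightarrow> k \<le> card (\<gamma> \<inter> A)}"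

text \<open>A nonzero coefficient at \<gamma> comes from splitting \<gamma> into two disjoint
  indices with nonzero coefficients in \<open>x\<close> and \<open>y\<close>; their numbers of
  elements in \<open>A\<close> add up.\<close>

lemma gen_filtration_mult:
  assumes "x \<in> gen_filtration A j" "y \<in> gen_filtration A k"
  shows "x * y \<in> gen_filtration A (j + k)"
proof -
  have "j + k \<le> card (\<gamma> \<inter> A)" if nz: "gcoeff (x * y) \<gamma> \<noteq> 0" for \<gamma>
  proof -
    \<comment> \<open>The cardinalities below need finite sets; as \<open>A\<close> is arbitrary,
      finiteness has to come from \<gamma>.\<close>
    have fin: "finite \<gamma>"
      using nz gconv_infinite by (auto simp: coeff_times)
    from nz obtain \<alpha> where \<alpha>: "\<alpha> \<subseteq> \<gamma>" "gcoeff x \<alpha> \<noteq> 0" "gcoeff y (\<gamma> - \<alpha>) \<noteq> 0"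
      unfolding coeff_times gconv_def by (metis (mono_tags, lifting) Pow_iff mult_zero_left
          mult_zero_right sum.neutral)
    have "\<gamma> \<inter> A = (\<alpha> \<inter> A) \<union> ((\<gamma> - \<alpha>) \<inter> A)" using \<alpha> by auto
    then have "card (\<gamma> \<inter> A) = card (\<alpha> \<inter> A) + card ((\<gamma> - \<alpha>) \<inter> A)"
      using fin \<alpha>(1) by (metis (no_types, lifting) Diff_disjoint Int_assoc Int_empty_left
          Int_left_commute card_Un_disjoint finite_Diff finite_Int finite_subset)
    then show ?thesis using assms \<alpha> by (simp add: gen_filtration_def add_mono)
  qed
  then show ?thesis by (simp add: gen_filtration_def)
qed

lemma gen_filtration_power:
  assumes "x \<in> gen_filtration A 1"
  shows "x ^ n \<in> gen_filtration A n"
proof (induction n)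
  case (Suc n)
  then show ?case using gen_filtration_mult[OF assms Suc] by simp
qed (simp add: gen_filtration_def)

text \<open>No index contains more than \<open>card A\<close> elements of \<open>A\<close>, so no
  coefficient of the power survives.\<close>

lemma gen_filtration_nilpotent:
  assumes "finite A" "x \<in> gen_filtration A 1" "card A < n"
  shows "x ^ n = 0"
proof (rule grassmann_eqI)
  fix \<gamma>
  have "card (\<gamma> \<inter> A) < n"
    using assms card_mono[of A "\<gamma> \<inter> A"] by auto
  then show "gcoeff (x ^ n) \<gamma> = gcoeff 0 \<gamma>"
    using gen_filtration_power[OF assms(2), of n] by (force simp: gen_filtration_def)
qed

lemma Lambda_soul_filtration:
  assumes "p \<in> Lambda" "body p = 0"
  shows "\<exists>A. finite A \<and> p \<in> gen_filtration A 1"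
proof (intro exI conjI)
  \<comment> \<open>All generators occurring in \<open>p\<close>. Body 0 excludes the empty index,
    so each index in the support meets \<open>A\<close>.\<close>
  define A where "A = \<Union>{\<alpha>. gcoeff p \<alpha> \<noteq> 0}"
  have fin: "finite \<alpha>" if "gcoeff p \<alpha> \<noteq> 0" for \<alpha>
    using coeff_outside[of \<alpha> p] that by (auto simp: gidx_def)
  show "finite A" using assms fin by (auto simp: A_def Lambda_def)
  have "1 \<le> card (\<alpha> \<inter> A)" if "gcoeff p \<alpha> \<noteq> 0" for \<alpha>
  proof -
    have "\<alpha> \<inter> A = \<alpha>" "\<alpha> \<noteq> {}" using that assms by (auto simp: A_def body_def)
    then show ?thesis using fin[OF that] by (simp add: Suc_le_eq card_gt_0_iff)
  qed
  then show "p \<in> gen_filtration A 1" by (simp add: gen_filtration_def)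
qed

lemma soul_approx:
  assumes "body s = 0" "e > 0"
  shows "\<exists>p\<in>Lambda. body p = 0 \<and> norm (s - p) < e"
proof -
  have "s \<in> closure Lambda" using Lambda_dense by simp
  \<comment> \<open>Half of \<open>e\<close> is kept for removing the body of \<open>w\<close>,
    which is bounded by \<open>norm (s - w)\<close> because \<open>s\<close> has body 0.\<close>
  then obtain w where w: "w \<in> Lambda" "dist w s < e / 2"
    using assms(2) by (meson closure_approachable half_gt_zero)
  define p where "p = w - scaleC (body w) 1"
  have "{\<alpha>. gcoeff p \<alpha> \<noteq> 0} \<subseteq> insert {} {\<alpha>. gcoeff w \<alpha> \<noteq> 0}"
    by (auto simp: p_def)
  then have "p \<in> Lambda" using w(1) by (auto simp: Lambda_def intro: finite_subset)
  moreover have "body p = 0" by (simp add: p_def body_def)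
  moreover have "norm (s - p) < e"
  proof -
    have "norm (s - p) \<le> norm (s - w) + norm (scaleC (body w) 1)"
      using norm_triangle_ineq[of "s - w" "scaleC (body w) 1"]
      by (simp add: p_def algebra_simps)
    also have "norm (scaleC (body w) 1) \<le> norm (s - w)"
      using coeff_le_norm[of "s - w" "{}"] assms(1) by (simp add: norm_scaleC body_def)
    finally show ?thesis using w(2) by (simp add: dist_norm norm_minus_commute)
  qed
  ultimately show ?thesis by blast
qed

lemma invertible_elem_one_minus_soul:
  assumes "body s = 0"
  shows "invertible_elem (1 - s)"
proof -
  obtain p where p: "p \<in> Lambda" "body p = 0" "norm (s - p) < 1"
    using soul_approx[OF assms, of 1] by auto
  obtain A where A: "finite A" "p \<in> gen_filtration A 1"
    using Lambda_soul_filtration[OF p(1,2)] by blast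
  have u: "invertible_elem (1 - (s - p))"
    by (intro invertible_elem_one_minus complete_algebra_summable_geometric p)
  then obtain v where v: "(1 - (s - p)) * v = 1"
    by (auto simp: invertible_elem_def)
  \<comment> \<open>Level 0 imposes no condition, so any \<open>v\<close> lies in it.\<close>
  have "v * p \<in> gen_filtration A 1"
    using gen_filtration_mult[OF _ A(2), of v 0] by (simp add: gen_filtration_def)
  then have "(v * p) ^ n = 0" if "n \<notin> {..card A}" for n
    using gen_filtration_nilpotent[OF A(1)] that by simp
  then have "invertible_elem (1 - v * p)"
    by (intro invertible_elem_one_minus summable_finite[of "{..card A}"]) auto
  \<comment> \<open>Expanding, \<open>(1 - (s - p)) * v\<close> collapses to 1 and leaves
    \<open>1 - (s - p) - p\<close>.\<close>
  moreover have "1 - s = (1 - (s - p)) * (1 - v * p)"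
    using v by (simp add: right_diff_distrib flip: mult.assoc)
  ultimately show ?thesis using u by (metis invertible_elem_mult)
qed

text \<open>The empty index splits only into two empty ones, with sign 1.\<close>

lemma body_mult: "body (x * y) = body x * body y"
  by (simp add: body_def coeff_times gconv_def)

theorem theorem2p13:
  fixes z :: grassmann
  shows "(\<exists>w. z * w = 1 \<and> w * z = 1) \<longleftrightarrow> body z \<noteq> 0"
proof
  assume "\<exists>w. z * w = 1 \<and> w * z = 1"
  then obtain w where "z * w = 1" by blast
  then have "body z * body w = body 1" using body_mult[of z w] by simp
  then show "body z \<noteq> 0" by (auto simp: body_def)
next
  assume nz: "body z \<noteq> 0"
  define c where "c = inverse (body z)"
  have "body (1 - scaleC c z) = 0" using nz by (simp add: body_def c_def)
  \<comment> \<open>Subtracting this soul from 1 gives back \<open>scaleC c z\<close>.\<close>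
  from invertible_elem_one_minus_soul[OF this]
  obtain w where "scaleC c z * w = 1" "w * scaleC c z = 1"
    by (auto simp: invertible_elem_def)
  then have "z * scaleC c w = 1" "scaleC c w * z = 1" by (simp_all add: scaleC_mult)
  then show "\<exists>w. z * w = 1 \<and> w * z = 1" by blast
qed

end
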